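(* Let $s(t)\in\mathcal{A}$, $t\ge 0$, be the (random) sequence of joint actions generated by the Distributed Inhomogeneous Synchronous Coverage Learning Algorithm (DISCL), described in the context, for the coverage game $\Gamma_{\mathrm{cov}}$, and let $z(t):=(s(t-1),s(t))$, which is a time-inhomogeneous Markov chain on $\mathcal{B}$. Then $$\lim_{t\to+\infty}\mathbb{P}\big(z(t)\in \mathrm{diag}(\mathcal{E}(\Gamma_{\mathrm{cov}}))\big)=1,$$ where $\mathcal{E}(\Gamma_{\mathrm{cov}})$ is the set of constrained Nash equilibria of $\Gamma_{\mathrm{cov}}$ and $\mathrm{diag}(\mathcal{E}(\Gamma_{\mathrm{cov}}))=\{(s,s): s\in\mathcal{E}(\Gamma_{\mathrm{cov}})\}$.
   Context: **Coverage game.** $V=\{1,\dots,N\}$ is the set of agents. The mission space is a convex planar region discretized into unit squares of a square lattice, and $\mathcal{Q}$ is the finite set of centers $q=(q_x,q_y)$ of the squares (integer coordinates). The location graph on $\mathcal{Q}$ joins $(q_x,q_y)$ and $(q_{x'},q_{y'})$ iff $|q_x-q_{x'}|+|q_y-q_{y'}|=1$; it is undirected, fixed and assumed connected, with diameter $D$. $\mathcal{N}^{\mathrm{loc}}_q$ is the set of neighbors of $q$. Each $q\in\mathcal{Q}$ carries a constant value $W_q\ge 0$. An action of agent $i$ is $s_i=(a_i,c_i)\in\mathcal{A}_i:=\mathcal{Q}\times\mathcal{C}$, with $a_i$ the position and $c_i=(\mathrm{FL}_i,\theta_i)$ the camera control vector (focal length and orientation) in a finite set $\mathcal{C}\subset[0,\mathrm{FL}_{\max}]\times[0,2\pi)$.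 The focal length determines the angle of view $\alpha_i\in[\alpha_{\min},\alpha_{\max}]$ and the shortest and longest ranges $r_i^{\mathrm{shrt}},r_i^{\mathrm{lng}}\in[r_{\min},r_{\max}]$. The sensor footprint $\mathcal{D}(a_i,c_i)\subset\mathbb{R}^2$ is the annulus sector centered at $a_i$, with radii from $r_i^{\mathrm{shrt}}$ to $r_i^{\mathrm{lng}}$, opening angle $\alpha_i$ and orientation $\theta_i$. Joint actions are $s=(s_1,\dots,s_N)\in\mathcal{A}:=\prod_i\mathcal{A}_i$; $s_{-i}$ denotes the actions of all agents other than $i$. Put $n_q(s):=|\{k\in V: q\in\mathcal{D}(a_k,c_k)\}|$, $f_i(c_i):=\frac12\alpha_i((r_i^{\mathrm{lng}})^2-(r_i^{\mathrm{shrt}})^2)$, and $$u_i(s)=\sum_{q\in\mathcal{D}(a_i,c_i)\cap\mathcal{Q}}\frac{W_q}{n_q(s)}-f_i(c_i).$$ The feasible actions of agent $i$ located at $a_i$ are $\mathcal{F}_i(a_i):=(\{a_i\}\cup\mathcal{N}^{\mathrm{loc}}_{a_i})\times\mathcal{C}$. A joint action $s^*$ (with positions $a_i^*$) is a constrained Nash equilibrium of $\Gamma_{\mathrm{cov}}$ if $u_i(s^* )\ge u_i(s_i,s^*_{-i})$ for all $i\in V$ and all $s_i\in\mathcal{F}_i(a_i^* )$; $\mathcal{E}(\Gamma_{\mathrm{cov}})$ is the set of these. $\mathcal{B}:=\{(s,s')\in\mathcal{A}\times\mathcal{A}: s_i'\in\mathcal{F}_i(a_i)\ \forall i\in V\}$,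 where $a_i$ is the position in $s_i$. **DISCL algorithm.** For $t\ge1$ let $\tau_i(t)=t$ if $u_i(s(t))\ge u_i(s(t-1))$ and $\tau_i(t)=t-1$ otherwise. Initialization: at $t=0$ each agent independently chooses its position uniformly in $\mathcal{Q}$ and its camera control vector uniformly in $\mathcal{C}$, giving $s(0)$; at $t=1$ all agents keep their actions (so $s(0)=s(1)=s(2)$). Update: at each $t\ge2$, with $\epsilon(t)=t^{-\frac{1}{N(D+1)}}$, each agent $i$, independently of the other agents given the past, chooses its next action $s_i(t+1)$ as follows: with probability $\epsilon(t)$ it experiments and draws $s_i(t+1)$ uniformly from $\mathcal{F}_i(a_i(t))\setminus\{s_i(\tau_i(t))\}$; with probability $1-\epsilon(t)$ it sets $s_i(t+1)=s_i(\tau_i(t))$. The sets sampled from are understood to be nonempty. *)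

theory Defs
  imports "HOL-Probability.Probability"
begin

type_synonym cell = "int \<times> int"
type_synonym camera = "real \<times> real"   \<comment> \<open>focal length and orientation\<close>
type_synonym action = "cell \<times> camera"
type_synonym joint_action = "nat \<Rightarrow> action"

text \<open>
  The focal length determines the angle of view and the two ranges through the maps
  \<open>aov\<close>, \<open>rshrt\<close>, \<open>rlng\<close>; these may differ from agent to agent (first argument).
\<close>

record coverage_data =
  nagents :: nat
  region :: "(real \<times> real) set"
  cells :: "cell set"
  weight :: "cell \<Rightarrow> real"
  cams :: "camera set"
  fl_max :: real
  aov :: "nat \<Rightarrow> real \<Rightarrow> real"
  aov_min :: real
  aov_max :: real
  rshrt :: "nat \<Rightarrow> real \<Rightarrow> real"
  rlng :: "nat \<Rightarrow> real \<Rightarrow> real"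
  r_min :: real
  r_max :: real

definition agents :: "coverage_data \<Rightarrow> nat set" where
  "agents G = {1..nagents G}"

definition cell_pt :: "cell \<Rightarrow> real \<times> real" where
  "cell_pt q = (real_of_int (fst q), real_of_int (snd q))"

definition unit_square :: "cell \<Rightarrow> (real \<times> real) set" where
  "unit_square q = cbox (cell_pt q - (1/2, 1/2)) (cell_pt q + (1/2, 1/2))"

definition loc_edges :: "coverage_data \<Rightarrow> (cell \<times> cell) set" where
  "loc_edges G = {(p, q). p \<in> cells G \<and> q \<in> cells G \<and>
      \<bar>fst p - fst q\<bar> + \<bar>snd p - snd q\<bar> = 1}"

definition loc_nbrs :: "coverage_data \<Rightarrow> cell \<Rightarrow> cell set" where
  "loc_nbrs G q = loc_edges G `` {q}"

definition loc_dist :: "coverage_data \<Rightarrow> cell \<Rightarrow> cell \<Rightarrow> nat" where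
  "loc_dist G p q = (LEAST n. (p, q) \<in> loc_edges G ^^ n)"

definition loc_diam :: "coverage_data \<Rightarrow> nat" where
  "loc_diam G = Max {loc_dist G p q | p q. p \<in> cells G \<and> q \<in> cells G}"

definition actions :: "coverage_data \<Rightarrow> action set" where
  "actions G = cells G \<times> cams G"

definition joint_actions :: "coverage_data \<Rightarrow> joint_action set" where
  "joint_actions G = (\<Pi>\<^sub>E i\<in>agents G. actions G)"

text \<open>
  The annulus sector is written in polar coordinates around the agent's position; the orientation
  is the direction of the bisector of the field of view.
\<close>

definition footprint :: "coverage_data \<Rightarrow> nat \<Rightarrow> cell \<Rightarrow> camera \<Rightarrow> (real \<times> real) set" where
  "footprint G i a c = {cell_pt a + (\<rho> * cos (snd c + \<phi>), \<rho> * sin (snd c + \<phi>)) | \<rho> \<phi>.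
      rshrt G i (fst c) \<le> \<rho> \<and> \<rho> \<le> rlng G i (fst c) \<and> \<bar>\<phi>\<bar> \<le> aov G i (fst c) / 2}"

definition visible :: "coverage_data \<Rightarrow> nat \<Rightarrow> action \<Rightarrow> cell set" where
  "visible G i x = {q \<in> cells G. cell_pt q \<in> footprint G i (fst x) (snd x)}"

definition n_cover :: "coverage_data \<Rightarrow> cell \<Rightarrow> joint_action \<Rightarrow> nat" where
  "n_cover G q s = card {k \<in> agents G. cell_pt q \<in> footprint G k (fst (s k)) (snd (s k))}"

definition energy :: "coverage_data \<Rightarrow> nat \<Rightarrow> camera \<Rightarrow> real" where
  "energy G i c = 1/2 * aov G i (fst c) * ((rlng G i (fst c))\<^sup>2 - (rshrt G i (fst c))\<^sup>2)"

definition utility :: "coverage_data \<Rightarrow> nat \<Rightarrow> joint_action \<Rightarrow> real" where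
  "utility G i s =
     (\<Sum>q\<in>visible G i (s i). weight G q / real (n_cover G q s)) - energy G i (snd (s i))"

definition feasible :: "coverage_data \<Rightarrow> cell \<Rightarrow> action set" where
  "feasible G a = ({a} \<union> loc_nbrs G a) \<times> cams G"

definition constrained_nash :: "coverage_data \<Rightarrow> joint_action set" where
  "constrained_nash G = {s \<in> joint_actions G.
     \<forall>i\<in>agents G. \<forall>x\<in>feasible G (fst (s i)). utility G i s \<ge> utility G i (s(i := x))}"

text \<open>
  In \<open>discretization\<close>, the cells include every lattice square lying inside the mission space and
  only squares meeting it, so that any convention for squares on the boundary is admitted.
  The last assumption says that the sets from which experimenting agents sample are nonempty.
\<close>

locale coverage_game =
  fixes G :: coverage_data
  assumes nagents_pos: "1 \<le> nagents G"
    and region_convex: "convex (region G)"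
    and discretization:
      "{q. unit_square q \<subseteq> region G} \<subseteq> cells G"
      "cells G \<subseteq> {q. unit_square q \<inter> region G \<noteq> {}}"
    and finite_cells: "finite (cells G)"
    and cells_nonempty: "cells G \<noteq> {}"
    and loc_connected: "\<And>p q. p \<in> cells G \<Longrightarrow> q \<in> cells G \<Longrightarrow> (p, q) \<in> (loc_edges G)\<^sup>*"
    and weight_nonneg: "\<And>q. q \<in> cells G \<Longrightarrow> 0 \<le> weight G q"
    and finite_cams: "finite (cams G)"
    and cams_nonempty: "cams G \<noteq> {}"
    and cams_subset: "cams G \<subseteq> {0..fl_max G} \<times> {0..<2 * pi}"
    and bounds_nonneg: "0 \<le> aov_min G" "0 \<le> r_min G"
    and aov_range: "\<And>i l. i \<in> agents G \<Longrightarrow> l \<in> fst ` cams G \<Longrightarrow>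
        aov G i l \<in> {aov_min G..aov_max G}"
    and r_range: "\<And>i l. i \<in> agents G \<Longrightarrow> l \<in> fst ` cams G \<Longrightarrow>
        r_min G \<le> rshrt G i l \<and> rshrt G i l \<le> rlng G i l \<and> rlng G i l \<le> r_max G"
    and sampling_nonempty:
      "\<And>a x. a \<in> cells G \<Longrightarrow> x \<in> feasible G a \<Longrightarrow> feasible G a - {x} \<noteq> {}"

text \<open>Below, \<open>x :: nat \<Rightarrow> joint_action\<close> is a realised trajectory, of which only the past
  up to time \<open>t\<close> is used.\<close>

definition explor_rate :: "coverage_data \<Rightarrow> nat \<Rightarrow> real" where
  "explor_rate G t = real t powr (- 1 / (real (nagents G) * (real (loc_diam G) + 1)))"

definition tau :: "coverage_data \<Rightarrow> (nat \<Rightarrow> joint_action) \<Rightarrow> nat \<Rightarrow> nat \<Rightarrow> nat" where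
  "tau G x i t = (if utility G i (x t) \<ge> utility G i (x (t - 1)) then t else t - 1)"

definition initial_law :: "coverage_data \<Rightarrow> joint_action pmf" where
  "initial_law G =
     Pi_pmf (agents G) undefined (\<lambda>_. pair_pmf (pmf_of_set (cells G)) (pmf_of_set (cams G)))"

definition agent_update :: "coverage_data \<Rightarrow> (nat \<Rightarrow> joint_action) \<Rightarrow> nat \<Rightarrow> nat \<Rightarrow> action pmf" where
  "agent_update G x t i =
     bind_pmf (bernoulli_pmf (explor_rate G t)) (\<lambda>experiment.
       if experiment then pmf_of_set (feasible G (fst (x t i)) - {x (tau G x i t) i})
       else return_pmf (x (tau G x i t) i))"

definition joint_update :: "coverage_data \<Rightarrow> (nat \<Rightarrow> joint_action) \<Rightarrow> nat \<Rightarrow> joint_action pmf" where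
  "joint_update G x t = Pi_pmf (agents G) undefined (agent_update G x t)"

text \<open>
  \<open>update\<close> expresses that, conditionally on the whole past \<open>S 0, \<dots>, S t\<close> being \<open>x 0, \<dots>, x t\<close>,
  the next joint action has law \<open>joint_update G x t\<close> (multiplied out by the probability of the
  conditioning event).
\<close>

locale discl_process = coverage_game G + prob_space M
  for G :: coverage_data and M :: "'w measure" +
  fixes S :: "nat \<Rightarrow> 'w \<Rightarrow> joint_action"
  assumes rv: "\<And>t. S t \<in> M \<rightarrow>\<^sub>M count_space (joint_actions G)"
    and initial: "\<And>y. prob {\<omega> \<in> space M. S 0 \<omega> = y} = pmf (initial_law G) y"
    and keep: "AE \<omega> in M. S 1 \<omega> = S 0 \<omega> \<and> S 2 \<omega> = S 1 \<omega>"
    and update: "\<And>t x y. 2 \<le> t \<Longrightarrow>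
        prob {\<omega> \<in> space M. (\<forall>k\<le>t. S k \<omega> = x k) \<and> S (Suc t) \<omega> = y} =
        prob {\<omega> \<in> space M. \<forall>k\<le>t. S k \<omega> = x k} * pmf (joint_update G x t) y"

definition chain :: "(nat \<Rightarrow> 'w \<Rightarrow> joint_action) \<Rightarrow> nat \<Rightarrow> 'w \<Rightarrow> joint_action \<times> joint_action" where
  "chain S t \<omega> = (S (t - 1) \<omega>, S t \<omega>)"

end

theory Submission
  imports Defs
begin

text \<open>
  Without experiments the chain settles on the diagonal. A single experiment out of \<open>(s, s)\<close>
  leads to another diagonal state exactly when the experimenter does not lose, and since the game
  has an exact potential, such moves never decrease the potential. Let \<open>K\<close> be the set of states all
  of whose successors under such moves are equilibria. It is closed under these moves, so leaving it
  takes two nearby experiments and happens at rate \<open>\<epsilon>(t)\<^sup>2\<close>, while from everywhere else it is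
  reachable by single experiments, which occur at rate \<open>\<epsilon>(t)\<close>. A Lyapunov function built from the
  distance to \<open>K\<close> therefore satisfies \<open>v(t+1) \<le> (1 - c \<epsilon>(t)) v(t) + o(\<epsilon>(t))\<close> in expectation, and
  \<open>v\<close> tends to 0 because \<open>\<epsilon>\<close> tends to 0 and is not summable.
\<close>

section \<open>Preliminaries\<close>

text \<open>Once \<open>b n < d\<close>, the difference \<open>a n - d\<close> is at most multiplied
  by \<open>1 - e n \<le> exp (- e n)\<close> at each step. These factors multiply to 0 because the
  sum of the \<open>e n\<close> diverges.\<close>

lemma contraction_tendsto_zero:
  fixes a b e :: "nat \<Rightarrow> real"
  assumes step: "\<forall>\<^sub>F n in sequentially. a (Suc n) \<le> (1 - e n) * a n + e n * b n"
    and a: "\<And>n. 0 \<le> a n"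
    and e: "\<forall>\<^sub>F n in sequentially. 0 \<le> e n \<and> e n \<le> 1" "\<not> summable e"
    and b: "b \<longlonglongrightarrow> 0"
  shows "a \<longlonglongrightarrow> 0"
proof (rule LIMSEQ_I)
  fix r :: real
  assume r: "0 < r"
  define d where "d = r / 2"
  have d: "0 < d" using r by (simp add: d_def)
  have "\<forall>\<^sub>F n in sequentially. b n < d"
    using b d by (rule order_tendstoD)
  with step e(1) have "\<forall>\<^sub>F n in sequentially.
      a (Suc n) \<le> (1 - e n) * a n + e n * b n \<and> 0 \<le> e n \<and> e n \<le> 1 \<and> b n < d"
    by eventually_elim auto
  then obtain m where m: "\<And>n. n \<ge> m \<Longrightarrow>
      a (Suc n) \<le> (1 - e n) * a n + e n * b n \<and> 0 \<le> e n \<and> e n \<le> 1 \<and> b n < d"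
    unfolding eventually_sequentially by blast
  have bound: "a (m + n) - d \<le> a m * exp (- (\<Sum>k<n. e (k + m)))" for n
  proof (induction n)
    case 0
    then show ?case using d by simp
  next
    case (Suc n)
    let ?n = "m + n"
    have s: "a (Suc ?n) \<le> (1 - e ?n) * a ?n + e ?n * b ?n" "0 \<le> e ?n" "e ?n \<le> 1" "b ?n < d"
      using m[of ?n] by auto
    have "e ?n * b ?n \<le> e ?n * d"
      using s by (intro mult_left_mono) auto
    then have "a (Suc ?n) - d \<le> (1 - e ?n) * (a ?n - d)"
      using s(1) by (simp add: algebra_simps)
    also have "\<dots> \<le> (1 - e ?n) * (a m * exp (- (\<Sum>k<n. e (k + m))))"
      using Suc s by (intro mult_left_mono) auto
    also have "\<dots> \<le> exp (- e ?n) * (a m * exp (- (\<Sum>k<n. e (k + m))))"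
      using exp_ge_add_one_self[of "- e ?n"] a[of m] by (intro mult_right_mono) auto
    also have "\<dots> = a m * exp (- (\<Sum>k<Suc n. e (k + m)))"
      by (simp add: mult_exp_exp add.commute)
    finally show ?case by simp
  qed
  have "\<not> summable (\<lambda>n. e (n + m))"
    using e(2) by (simp add: summable_iff_shift)
  have "filterlim (\<lambda>n. \<Sum>k<n. e (k + m)) at_top sequentially"
  proof -
    have nn: "0 \<le> e (k + m)" for k using m[of "k + m"] by simp
    have "\<exists>n. C \<le> (\<Sum>k<n. e (k + m))" for C
    proof (rule ccontr)
      assume "\<nexists>n. C \<le> (\<Sum>k<n. e (k + m))"
      then have "(\<Sum>k<n. e (k + m)) \<le> C" for n
        using linear by blast
      then have "summable (\<lambda>n. e (n + m))"
        using nn by (intro summableI_nonneg_bounded) auto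
      with \<open>\<not> summable (\<lambda>n. e (n + m))\<close> show False by simp
    qed
    moreover have le: "(\<Sum>k<n. e (k + m)) \<le> (\<Sum>k<n'. e (k + m))" if "n \<le> n'" for n n'
      using that nn by (intro sum_mono2) auto
    ultimately have "\<exists>n. \<forall>n'\<ge>n. C \<le> (\<Sum>k<n'. e (k + m))" for C
      by (metis order_trans)
    then show ?thesis
      by (simp add: filterlim_at_top eventually_sequentially)
  qed
  then have "filterlim (\<lambda>n. - (\<Sum>k<n. e (k + m))) at_bot sequentially"
    by (simp add: filterlim_uminus_at_bot)
  from tendsto_mult[OF tendsto_const filterlim_compose[OF exp_at_bot this]]
  have "(\<lambda>n. a m * exp (- (\<Sum>k<n. e (k + m)))) \<longlonglongrightarrow> a m * 0" .
  then have "\<forall>\<^sub>F n in sequentially. a m * exp (- (\<Sum>k<n. e (k + m))) < d"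
    using d by (auto dest: order_tendstoD)
  then obtain l where l: "\<And>n. n \<ge> l \<Longrightarrow> a m * exp (- (\<Sum>k<n. e (k + m))) < d"
    unfolding eventually_sequentially by blast
  have "norm (a n - 0) < r" if "n \<ge> m + l" for n
  proof -
    have k: "m + (n - m) = n" "l \<le> n - m"
      using that by auto
    show ?thesis
      using bound[of "n - m"] l[OF k(2)] a[of n] by (simp add: d_def k(1))
  qed
  then show "\<exists>no. \<forall>n\<ge>no. norm (a n - 0) < r" by blast
qed

text \<open>The tail of the geometric series from \<open>n\<close> on is at most
  \<open>l ^ n / (1 - l)\<close>, and \<open>1 - l \<ge> 1 / 2\<close>. With \<open>m\<close>
  arbitrary, this limits the damage of a jump to any larger index.\<close>

lemma geometric_sum_le_add:
  fixes l :: real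
  assumes l: "0 < l" "l \<le> 1 / 2"
  shows "(\<Sum>j<m. l ^ j) \<le> (\<Sum>j<n. l ^ j) + 2 * l ^ n"
proof -
  have eq: "(1 - l) * (\<Sum>j<n. l ^ j) = 1 - l ^ n" for n
    using one_diff_power_eq[of l n] by simp
  have "(1 - l) * ((\<Sum>j<n. l ^ j) + 2 * l ^ n) = 1 - l ^ n + 2 * (1 - l) * l ^ n"
    unfolding distrib_left eq by simp
  moreover have "1 * l ^ n \<le> 2 * (1 - l) * l ^ n"
    using l by (intro mult_right_mono) auto
  moreover have "(1 - l) * (\<Sum>j<m. l ^ j) \<le> 1"
    using l unfolding eq by simp
  ultimately have "(1 - l) * (\<Sum>j<m. l ^ j) \<le> (1 - l) * ((\<Sum>j<n. l ^ j) + 2 * l ^ n)"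
    by linarith
  then show ?thesis using l by simp
qed

lemma prob_Pi_pmf_ne_le:
  assumes A: "finite A" and e: "\<And>i. i \<in> A \<Longrightarrow> measure_pmf.prob (p i) (- {m i}) = e"
  shows "measure_pmf.prob (Pi_pmf A d p) {y. \<exists>i\<in>A. y i \<noteq> m i} \<le> real (card A) * e"
proof -
  have "measure_pmf.prob (Pi_pmf A d p) {y. y i \<noteq> m i} = e" if "i \<in> A" for i
  proof -
    have "measure_pmf.prob (map_pmf (\<lambda>y. y i) (Pi_pmf A d p)) (- {m i}) = e"
      using A e that by (simp add: Pi_pmf_component)
    then show ?thesis by (simp add: vimage_def)
  qed
  then have "measure_pmf.prob (Pi_pmf A d p) (\<Union>i\<in>A. {y. y i \<noteq> m i}) \<le> (\<Sum>i\<in>A. e)"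
    using A by (intro order_trans[OF measure_pmf.finite_measure_subadditive_finite]) auto
  moreover have "(\<Union>i\<in>A. {y. y i \<noteq> m i}) = {y. \<exists>i\<in>A. y i \<noteq> m i}" by auto
  ultimately show ?thesis by simp
qed

text \<open>A union bound over ordered pairs: two different coordinates contribute
  \<open>e\<^sup>2\<close> by independence, and pairs with \<open>i = j\<close> contribute the empty
  event.\<close>

lemma prob_Pi_pmf_ne2_le:
  assumes A: "finite A" and e: "\<And>i. i \<in> A \<Longrightarrow> measure_pmf.prob (p i) (- {m i}) = e"
  shows "measure_pmf.prob (Pi_pmf A d p) {y. \<exists>i\<in>A. \<exists>j\<in>A. i \<noteq> j \<and> y i \<noteq> m i \<and> y j \<noteq> m j}
    \<le> (real (card A))\<^sup>2 * e\<^sup>2"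
proof -
  let ?X = "\<lambda>(i, j). {y. i \<noteq> j \<and> y i \<noteq> m i \<and> y j \<noteq> m j}"
  have le: "measure_pmf.prob (Pi_pmf A d p) (?X ij) \<le> e\<^sup>2" if ij: "ij \<in> A \<times> A" for ij
  proof -
    obtain i j where [simp]: "ij = (i, j)" and ij: "i \<in> A" "j \<in> A"
      using ij by auto
    show ?thesis
    proof (cases "i = j")
      case False
      define B where "B k = (if k = i \<or> k = j then - {m k} else UNIV)" for k
      have "?X ij = Pi A B"
        using ij False by (auto simp: B_def Pi_def)
      then have "measure_pmf.prob (Pi_pmf A d p) (?X ij)
          = (\<Prod>k\<in>A. measure_pmf.prob (p k) (B k))"
        using A by (simp add: measure_Pi_pmf_Pi)
      also have "\<dots> = (\<Prod>k\<in>{i, j}. measure_pmf.prob (p k) (B k))"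
        using A ij by (intro prod.mono_neutral_right) (auto simp: B_def)
      also have "\<dots> = e\<^sup>2"
        using False ij e by (simp add: B_def power2_eq_square)
      finally show ?thesis by simp
    qed simp
  qed
  have "measure_pmf.prob (Pi_pmf A d p) (\<Union>ij\<in>A \<times> A. ?X ij) \<le> (\<Sum>ij\<in>A \<times> A. e\<^sup>2)"
    using A le by (intro order_trans[OF measure_pmf.finite_measure_subadditive_finite] sum_mono) auto
  moreover have "(\<Union>ij\<in>A \<times> A. ?X ij)
      = {y. \<exists>i\<in>A. \<exists>j\<in>A. i \<noteq> j \<and> y i \<noteq> m i \<and> y j \<noteq> m j}" by auto
  ultimately show ?thesis by (simp add: card_cartesian_product power2_eq_square)
qed

text \<open>Here \<open>g\<close> is a base value, \<open>C\<close> bounds the excess on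
  \<open>X\<close>, and \<open>d\<close> is a gain credited to the outcome \<open>y0\<close>.
  Averaging the pointwise bound turns the indicators into probabilities.\<close>

lemma sum_pmf_bound:
  assumes A: "finite A" "set_pmf p \<subseteq> A" "y0 \<in> A" "0 \<le> C"
    and h: "\<And>y. y \<in> A \<Longrightarrow> h y \<le> g + C * indicator X y - d * indicator {y0} y"
  shows "(\<Sum>y\<in>A. pmf p y * h y) \<le> g + C * measure_pmf.prob p X - (d :: real) * pmf p y0"
proof -
  have "(\<Sum>y\<in>A. pmf p y * h y)
      \<le> (\<Sum>y\<in>A. pmf p y * (g + C * indicator X y - d * indicator {y0} y))"
    using h by (intro sum_mono mult_left_mono) auto
  also have "\<dots> = g * (\<Sum>y\<in>A. pmf p y) + C * (\<Sum>y\<in>A. pmf p y * indicator X y)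
      - d * (\<Sum>y\<in>A. pmf p y * indicator {y0} y)"
    by (simp add: sum.distrib sum_subtractf sum_distrib_left ring_distribs mult.left_commute mult.commute)
  also have "(\<Sum>y\<in>A. pmf p y) = 1"
    using A by (intro sum_pmf_eq_1)
  also have "(\<Sum>y\<in>A. pmf p y * indicator X y) = measure_pmf.prob p (A \<inter> X)"
    using A by (simp add: measure_measure_pmf_finite sum.inter_restrict indicator_def if_distrib)
  also have "(\<Sum>y\<in>A. pmf p y * indicator {y0} y) = pmf p y0"
    using A by (simp add: indicator_def if_distrib sum.delta')
  finally show ?thesis
    using A mult_left_mono[OF measure_pmf.finite_measure_mono[of "A \<inter> X" X p], of C] by simp
qed

section \<open>The coverage game is a potential game\<close>

text \<open>Rosenthal's potential of a congestion game, less the private energy costs. The agent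
  that covers \<open>q\<close> as the \<open>n\<close>-th one adds \<open>weight G q / n\<close>,
  which is its share in \<open>utility\<close>.\<close>

definition cov_potential :: "coverage_data \<Rightarrow> joint_action \<Rightarrow> real" where
  "cov_potential G s =
     (\<Sum>q\<in>cells G. weight G q * harm (n_cover G q s)) - (\<Sum>i\<in>agents G. energy G i (snd (s i)))"

context coverage_game
begin

lemma finite_agents [simp]: "finite (agents G)"
  by (simp add: agents_def)

lemma card_agents [simp]: "card (agents G) = nagents G"
  by (simp add: agents_def)

lemma finite_actions [simp]: "finite (actions G)"
  using finite_cells finite_cams by (simp add: actions_def)

lemma actions_nonempty: "actions G \<noteq> {}"
  using cells_nonempty cams_nonempty by (auto simp: actions_def)

lemma finite_joint_actions [simp]: "finite (joint_actions G)"
  by (simp add: joint_actions_def finite_PiE)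

lemma joint_actions_arb: "s \<in> joint_actions G \<Longrightarrow> i \<notin> agents G \<Longrightarrow> s i = undefined"
  by (auto simp: joint_actions_def)

lemma feasible_subset_actions:
  "x \<in> actions G \<Longrightarrow> feasible G (fst x) \<subseteq> actions G"
  by (auto simp: feasible_def actions_def loc_nbrs_def loc_edges_def)

lemma joint_actions_upd:
  assumes "s \<in> joint_actions G" "i \<in> agents G" "x \<in> feasible G (fst (s i))"
  shows "s(i := x) \<in> joint_actions G"
proof -
  have "s i \<in> actions G" using assms by (auto simp: joint_actions_def)
  with assms(3) have "x \<in> actions G" using feasible_subset_actions by blast
  with assms(1,2) show ?thesis by (auto simp: joint_actions_def PiE_def extensional_def)
qed

text \<open>For each agent the potential is its utility plus a term in which its own action does not
  occur, so a change of this action moves both by the same amount.\<close>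

lemma potential_difference:
  assumes i: "i \<in> agents G"
  shows "cov_potential G (s(i := x)) - cov_potential G s = utility G i (s(i := x)) - utility G i s"
proof -
  define sees where
    "sees k s q \<longleftrightarrow> cell_pt q \<in> footprint G k (fst (s k)) (snd (s k))" for k and s :: joint_action and q
  define others where "others s q = card {k \<in> agents G - {i}. sees k s q}" for s q
  have n: "n_cover G q s = others s q + (if sees i s q then 1 else 0)" for q s
  proof -
    have "{k \<in> agents G. sees k s q}
        = {k \<in> agents G - {i}. sees k s q} \<union> (if sees i s q then {i} else {})"
      using i by auto
    then show ?thesis by (simp add: n_cover_def others_def sees_def)
  qed
  have harm: "weight G q * harm (n_cover G q s) = weight G q * harm (others s q)
      + (if sees i s q then weight G q / real (n_cover G q s) else 0)" for q s
    by (simp add: n harm_Suc field_simps)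
  have vis: "visible G i (s i) = {q \<in> cells G. sees i s q}" for s
    by (auto simp: visible_def sees_def)
  have pot: "cov_potential G s = utility G i s + ((\<Sum>q\<in>cells G. weight G q * harm (others s q))
      - (\<Sum>j\<in>agents G - {i}. energy G j (snd (s j))))" for s
    using finite_cells i
    by (simp add: cov_potential_def harm sum.distrib utility_def vis sum.inter_filter
        sum.remove[of "agents G" i])
  have "others (s(i := x)) q = others s q" for q
    unfolding others_def sees_def by (rule arg_cong[where f = card]) auto
  moreover have "(\<Sum>j\<in>agents G - {i}. energy G j (snd ((s(i := x)) j)))
      = (\<Sum>j\<in>agents G - {i}. energy G j (snd (s j)))"
    by (rule sum.cong) auto
  ultimately show ?thesis by (simp add: pot)
qed

end

text \<open>The inequality is weak because an experimenter keeps its new action in case of a tie.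
  Apart from the trivial case \<open>x = s i\<close>, these are the moves that a single experiment
  out of \<open>(s, s)\<close> can make permanent.\<close>

definition better_reply :: "coverage_data \<Rightarrow> (joint_action \<times> joint_action) set" where
  "better_reply G = {(s, s(i := x)) | s i x. s \<in> joint_actions G \<and> i \<in> agents G \<and>
     x \<in> feasible G (fst (s i)) \<and> utility G i s \<le> utility G i (s(i := x))}"

text \<open>Utility ties make it possible to leave a Nash equilibrium by a single experiment, so the
  equilibria themselves need not be stable; the states below are.\<close>

definition stable_nash :: "coverage_data \<Rightarrow> joint_action set" where
  "stable_nash G = {s \<in> joint_actions G. (better_reply G)\<^sup>* `` {s} \<subseteq> constrained_nash G}"

section \<open>Better-reply paths and stable equilibria\<close>

context coverage_game
begin

lemma better_reply_joint_actions: "(s, s') \<in> better_reply G \<Longrightarrow> s' \<in> joint_actions G"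
  using joint_actions_upd by (auto simp: better_reply_def)

lemma better_replies_joint_actions:
  "(s, s') \<in> (better_reply G)\<^sup>* \<Longrightarrow> s \<in> joint_actions G \<Longrightarrow> s' \<in> joint_actions G"
  by (induction rule: rtrancl_induct) (auto dest: better_reply_joint_actions)

lemma better_replies_potential:
  "(s, s') \<in> (better_reply G)\<^sup>* \<Longrightarrow> cov_potential G s \<le> cov_potential G s'"
proof (induction rule: rtrancl_induct)
  case (step y z)
  then obtain i x where "i \<in> agents G" "z = y(i := x)" "utility G i y \<le> utility G i (y(i := x))"
    by (auto simp: better_reply_def)
  with potential_difference[of i y x] have "cov_potential G y \<le> cov_potential G z" by simp
  with step.IH show ?case by (rule order_trans)
qed simp

lemma stable_nash_closed:
  assumes "s \<in> stable_nash G" "(s, s') \<in> better_reply G"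
  shows "s' \<in> stable_nash G"
proof -
  have "(better_reply G)\<^sup>* `` {s'} \<subseteq> (better_reply G)\<^sup>* `` {s}"
    using converse_rtrancl_into_rtrancl[OF assms(2)] by blast
  with assms show ?thesis
    unfolding stable_nash_def using better_reply_joint_actions by blast
qed

lemma stable_nash_subset: "stable_nash G \<subseteq> constrained_nash G"
  by (auto simp: stable_nash_def)

text \<open>A potential maximizer among the states reachable from \<open>s\<close> is stable: whatever it reaches
  has the same potential, hence admits no strict improvement.\<close>

lemma stable_nash_reachable:
  assumes s: "s \<in> joint_actions G"
  obtains n s' where "s' \<in> stable_nash G" "(s, s') \<in> better_reply G ^^ n"
proof -
  let ?R = "(better_reply G)\<^sup>* `` {s}"
  have "?R \<subseteq> joint_actions G"
    using s by (auto dest: better_replies_joint_actions)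
  then have fin: "finite ?R"
    using finite_joint_actions finite_subset by blast
  have "finite (cov_potential G ` ?R)" "cov_potential G ` ?R \<noteq> {}"
    using fin by auto
  from Max_in[OF this] obtain m where m: "m \<in> ?R" "cov_potential G m = Max (cov_potential G ` ?R)"
    by auto
  have "k \<in> constrained_nash G" if k: "(m, k) \<in> (better_reply G)\<^sup>*" for k
  proof (rule ccontr)
    assume "k \<notin> constrained_nash G"
    moreover have kA: "k \<in> joint_actions G"
      using k m \<open>?R \<subseteq> joint_actions G\<close> better_replies_joint_actions by blast
    ultimately obtain i x where ix: "i \<in> agents G" "x \<in> feasible G (fst (k i))"
        "utility G i k < utility G i (k(i := x))"
      by (auto simp: constrained_nash_def not_le)
    then have "(k, k(i := x)) \<in> better_reply G"
      unfolding better_reply_def using kA less_imp_le by blast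
    with k m(1) have "k(i := x) \<in> ?R" by auto
    then have "cov_potential G (k(i := x)) \<le> cov_potential G m"
      using fin m(2) by simp
    moreover have "cov_potential G m \<le> cov_potential G k"
      using k by (rule better_replies_potential)
    ultimately show False
      using potential_difference[OF ix(1), of k x] ix(3) by simp
  qed
  then have "m \<in> stable_nash G"
    using m(1) \<open>?R \<subseteq> joint_actions G\<close> by (auto simp: stable_nash_def)
  with m(1) that show thesis by (auto simp: rtrancl_power)
qed

end

text \<open>By \<open>stable_nash_reachable\<close> such an \<open>n\<close> exists for every joint
  action, so \<open>LEAST\<close> gives the length of a shortest path.\<close>

definition stable_dist :: "coverage_data \<Rightarrow> joint_action \<Rightarrow> nat" where
  "stable_dist G s = (LEAST n. \<exists>s'\<in>stable_nash G. (s, s') \<in> better_reply G ^^ n)"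

context coverage_game
begin

lemma stable_dist_eq_0: "s \<in> stable_nash G \<Longrightarrow> stable_dist G s = 0"
  unfolding stable_dist_def by (rule Least_eq_0) auto

lemma stable_dist_step:
  assumes s: "s \<in> joint_actions G" "s \<notin> stable_nash G"
  obtains s' where "(s, s') \<in> better_reply G" "stable_dist G s' < stable_dist G s"
proof -
  have "\<exists>n. \<exists>s'\<in>stable_nash G. (s, s') \<in> better_reply G ^^ n"
    using stable_nash_reachable[OF s(1)] by metis
  from LeastI_ex[OF this] obtain k
    where k: "k \<in> stable_nash G" "(s, k) \<in> better_reply G ^^ stable_dist G s"
    unfolding stable_dist_def by blast
  then obtain n where n: "stable_dist G s = Suc n"
    using s(2) by (cases "stable_dist G s") auto
  with k(2) obtain s' where s': "(s, s') \<in> better_reply G" "(s', k) \<in> better_reply G ^^ n"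
    by (metis relpow_Suc_D2)
  have "stable_dist G s' \<le> n"
    unfolding stable_dist_def using s'(2) k(1) by (intro Least_le) auto
  with n s'(1) that show thesis by simp
qed

end

section \<open>The dynamics without experiments\<close>

text \<open>The joint action played when nobody experiments, for \<open>a\<close> the previous and
  \<open>b\<close> the current one: the choice made by \<open>tau\<close>, with ties in favor of the
  newer action.\<close>

definition revert :: "coverage_data \<Rightarrow> joint_action \<Rightarrow> joint_action \<Rightarrow> joint_action" where
  "revert G a b = (\<lambda>i. if utility G i a \<le> utility G i b then b i else a i)"

definition unperturbed :: "coverage_data \<Rightarrow> joint_action \<times> joint_action \<Rightarrow> joint_action \<times> joint_action" where
  "unperturbed G = (\<lambda>(a, b). (b, revert G a b))"

lemma unperturbed_diag: "(unperturbed G ^^ n) (s, s) = (s, s)"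
  by (induction n) (auto simp: unperturbed_def revert_def)

text \<open>Only agents that moved in the previous step can move. If two consecutive steps do not shrink
  this set, all of its members reverted twice, so each would prefer both of two
  joint actions strictly to the other.\<close>

lemma unperturbed_reaches_diag:
  assumes "finite {i. a i \<noteq> b i}" "card {i. a i \<noteq> b i} \<le> n"
  shows "\<exists>s. (unperturbed G ^^ (2 * n)) (a, b) = (s, s)"
  using assms
proof (induction n arbitrary: a b)
  case 0
  then have "{i. a i \<noteq> b i} = {}" by simp
  then have "a = b" by auto
  then show ?case by simp
next
  case (Suc n)
  define a' where "a' = revert G a b"
  define b' where "b' = revert G b a'"
  have sub1: "{i. b i \<noteq> a' i} \<subseteq> {i. a i \<noteq> b i}"
    by (auto simp: a'_def revert_def)
  have sub2: "{i. a' i \<noteq> b' i} \<subseteq> {i. b i \<noteq> a' i}"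
    by (auto simp: b'_def revert_def)
  show ?case
  proof (cases "a = b")
    case True
    then show ?thesis using unperturbed_diag by blast
  next
    case False
    have "{i. a' i \<noteq> b' i} \<noteq> {i. a i \<noteq> b i}"
    proof
      assume eq: "{i. a' i \<noteq> b' i} = {i. a i \<noteq> b i}"
      \<comment> \<open>Agents with \<open>a i = b i\<close> keep this action under
        \<open>revert\<close>, and all others have gone back to \<open>a i\<close>. So the whole
        joint action recurs, and with it every utility.\<close>
      have "a' = a"
      proof
        fix i
        have "a i \<noteq> b i \<Longrightarrow> b i \<noteq> a' i" using eq sub2 by blast
        then show "a' i = a i" by (cases "a i = b i") (auto simp: a'_def revert_def)
      qed
      obtain i where i: "a i \<noteq> b i" using False by auto
      then have "i \<in> {i. a' i \<noteq> b' i}" using eq by simp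
      moreover from this have "i \<in> {i. b i \<noteq> a' i}" using sub2 by (rule set_rev_mp)
      ultimately have "a' i \<noteq> b i" "a' i \<noteq> b' i" by auto
      then have "\<not> utility G i a \<le> utility G i b" "\<not> utility G i b \<le> utility G i a'"
        by (auto simp: a'_def b'_def revert_def split: if_splits)
      with \<open>a' = a\<close> show False by simp
    qed
    then have lt: "{i. a' i \<noteq> b' i} \<subset> {i. a i \<noteq> b i}"
      using sub1 sub2 by auto
    then have "card {i. a' i \<noteq> b' i} < card {i. a i \<noteq> b i}"
      using Suc.prems(1) by (intro psubset_card_mono)
    moreover have "finite {i. a' i \<noteq> b' i}"
      using lt Suc.prems(1) by (meson finite_subset psubset_imp_subset)
    ultimately obtain s where "(unperturbed G ^^ (2 * n)) (a', b') = (s, s)"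
      using Suc.IH Suc.prems(2) by fastforce
    moreover have "(unperturbed G ^^ (2 * Suc n)) (a, b) = (unperturbed G ^^ (2 * n)) (a', b')"
    proof -
      have "unperturbed G (unperturbed G (a, b)) = (a', b')"
        by (simp add: unperturbed_def a'_def b'_def)
      then show ?thesis
        by (simp only: mult_Suc_right add_2_eq_Suc funpow_Suc_right o_apply)
    qed
    ultimately show ?thesis by auto
  qed
qed

text \<open>By \<open>unperturbed_settles\<close> this many steps lead from any two joint actions to
  the diagonal, so both components agree there.\<close>

definition limit_state :: "coverage_data \<Rightarrow> joint_action \<times> joint_action \<Rightarrow> joint_action" where
  "limit_state G z = fst ((unperturbed G ^^ (2 * nagents G)) z)"

lemma limit_state_diag [simp]: "limit_state G (s, s) = s"
  by (simp add: limit_state_def unperturbed_diag)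

context coverage_game
begin

lemma unperturbed_settles:
  assumes "a \<in> joint_actions G" "b \<in> joint_actions G"
  shows "\<exists>s. (unperturbed G ^^ (2 * nagents G)) (a, b) = (s, s)"
proof -
  have sub: "{i. a i \<noteq> b i} \<subseteq> agents G"
  proof
    fix i
    assume "i \<in> {i. a i \<noteq> b i}"
    then show "i \<in> agents G"
      using joint_actions_arb[OF assms(1), of i] joint_actions_arb[OF assms(2), of i]
      by (cases "i \<in> agents G") auto
  qed
  show ?thesis
  proof (rule unperturbed_reaches_diag)
    show "finite {i. a i \<noteq> b i}" using sub by (rule finite_subset) simp
    show "card {i. a i \<noteq> b i} \<le> nagents G" using card_mono[OF finite_agents sub] by simp
  qed
qed

lemma revert_joint_actions:
  assumes "a \<in> joint_actions G" "b \<in> joint_actions G"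
  shows "revert G a b \<in> joint_actions G"
  using assms by (auto simp: joint_actions_def revert_def PiE_def extensional_def)

text \<open>Starting one step later amounts to one further step at the end, and diagonal states are
  fixed.\<close>

lemma limit_state_revert:
  assumes "a \<in> joint_actions G" "b \<in> joint_actions G"
  shows "limit_state G (b, revert G a b) = limit_state G (a, b)"
proof -
  obtain s where s: "(unperturbed G ^^ (2 * nagents G)) (a, b) = (s, s)"
    using unperturbed_settles[OF assms] by blast
  have "(unperturbed G ^^ (2 * nagents G)) (b, revert G a b)
      = (unperturbed G ^^ (2 * nagents G)) (unperturbed G (a, b))"
    by (simp add: unperturbed_def)
  also have "\<dots> = unperturbed G ((unperturbed G ^^ (2 * nagents G)) (a, b))"
    by (rule funpow_swap1[symmetric])
  also have "\<dots> = (s, s)"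
    unfolding s by (simp add: unperturbed_def revert_def)
  finally show ?thesis by (simp add: limit_state_def s)
qed

text \<open>A deviation that does not lose is adopted at once. A losing one is undone in two steps,
  from \<open>(s, s(i := x))\<close> through \<open>(s(i := x), s)\<close> to
  \<open>(s, s)\<close>.\<close>

lemma limit_state_deviation:
  assumes s: "s \<in> joint_actions G" "s(i := x) \<in> joint_actions G"
  shows "limit_state G (s, s(i := x)) =
    (if utility G i s \<le> utility G i (s(i := x)) then s(i := x) else s)"
proof -
  let ?y = "s(i := x)"
  have r: "revert G s ?y = (if utility G i s \<le> utility G i ?y then ?y else s)"
    by (auto simp: revert_def)
  have *: "limit_state G (s, ?y) = limit_state G (?y, revert G s ?y)"
    using s by (simp only: limit_state_revert)
  show ?thesis
  proof (cases "utility G i s \<le> utility G i ?y")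
    case False
    then have "revert G ?y s = s"
      by (auto simp: revert_def)
    moreover have "limit_state G (?y, s) = limit_state G (s, revert G ?y s)"
      using s by (simp only: limit_state_revert)
    ultimately show ?thesis using False * by (simp add: r)
  qed (use * in \<open>simp add: r\<close>)
qed

end

section \<open>The law of one update\<close>

definition agent_transition ::
  "coverage_data \<Rightarrow> nat \<Rightarrow> joint_action \<Rightarrow> joint_action \<Rightarrow> nat \<Rightarrow> action pmf" where
  "agent_transition G t a b i =
     bind_pmf (bernoulli_pmf (explor_rate G t)) (\<lambda>experiment.
       if experiment then pmf_of_set (feasible G (fst (b i)) - {revert G a b i})
       else return_pmf (revert G a b i))"

definition transition ::
  "coverage_data \<Rightarrow> nat \<Rightarrow> joint_action \<Rightarrow> joint_action \<Rightarrow> joint_action pmf" where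
  "transition G t a b = Pi_pmf (agents G) undefined (agent_transition G t a b)"

text \<open>The time \<open>tau G x i t\<close> selects between the last two joint actions just as
  \<open>revert\<close> does, so the earlier past does not enter. This is the source of the Markov
  property.\<close>

lemma joint_update_eq: "joint_update G x t = transition G t (x (t - 1)) (x t)"
proof -
  have "agent_update G x t = agent_transition G t (x (t - 1)) (x t)"
  proof
    fix i
    have "x (tau G x i t) i = revert G (x (t - 1)) (x t) i"
      by (simp add: tau_def revert_def)
    then show "agent_update G x t i = agent_transition G t (x (t - 1)) (x t) i"
      unfolding agent_update_def agent_transition_def by (rule ssubst) (rule refl)
  qed
  then show ?thesis by (simp add: joint_update_def transition_def)
qed

text \<open>The transition operator of the pair chain at time \<open>t\<close>, applied to
  \<open>g\<close>.\<close>

definition step_exp ::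
  "coverage_data \<Rightarrow> nat \<Rightarrow> (joint_action \<times> joint_action \<Rightarrow> real) \<Rightarrow> joint_action \<times> joint_action \<Rightarrow> real"
  where
  "step_exp G t g = (\<lambda>(a, b). \<Sum>y\<in>joint_actions G. pmf (transition G t a b) y * g (b, y))"

section \<open>Exploration rate and one-step probabilities\<close>

context coverage_game
begin

lemma explor_rate_bounds:
  assumes "1 \<le> t"
  shows "0 \<le> explor_rate G t" "explor_rate G t \<le> 1"
proof -
  have "real t powr (- 1 / (real (nagents G) * (real (loc_diam G) + 1))) \<le> real t powr 0"
    using assms by (intro powr_mono) auto
  then show "explor_rate G t \<le> 1" using assms by (simp add: explor_rate_def)
qed (simp add: explor_rate_def)

lemma explor_rate_tendsto: "explor_rate G \<longlonglongrightarrow> 0"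
proof -
  have "- 1 / (real (nagents G) * (real (loc_diam G) + 1)) < 0"
    using nagents_pos by (simp add: divide_neg_pos)
  from tendsto_neg_powr[OF this filterlim_real_sequentially] show ?thesis
    by (simp add: explor_rate_def[abs_def])
qed

text \<open>The product of \<open>nagents G\<close> and \<open>loc_diam G + 1\<close> is at least 1,
  so the exponent is at least -1, as for the harmonic series.\<close>

lemma explor_rate_not_summable: "\<not> summable (explor_rate G)"
proof -
  have "1 \<le> real (nagents G) * (real (loc_diam G) + 1)"
    using nagents_pos mult_mono[of 1 "real (nagents G)" 1 "real (loc_diam G) + 1"] by simp
  then have "\<not> - 1 / (real (nagents G) * (real (loc_diam G) + 1)) < - 1"
    by (simp add: field_simps)
  then show ?thesis
    unfolding explor_rate_def[abs_def] summable_real_powr_iff .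
qed

lemma experiment_set:
  assumes "b \<in> joint_actions G" "i \<in> agents G"
  shows "feasible G (fst (b i)) - {x} \<noteq> {}" "feasible G (fst (b i)) - {x} \<subseteq> actions G"
    "finite (feasible G (fst (b i)) - {x})"
proof -
  have bi: "b i \<in> actions G"
    using assms by (auto simp: joint_actions_def)
  then have "b i \<in> feasible G (fst (b i))"
    by (auto simp: feasible_def actions_def mem_Times_iff)
  moreover have "fst (b i) \<in> cells G"
    using bi by (auto simp: actions_def)
  \<comment> \<open>\<open>sampling_nonempty\<close> speaks of \<open>x\<close> inside the feasible
    set. A value outside it can occur, as arbitrary pairs of joint actions serve as states; then
    nothing is removed and \<open>b i\<close> is left.\<close>
  ultimately show "feasible G (fst (b i)) - {x} \<noteq> {}"
    using sampling_nonempty[of "fst (b i)" x] by (cases "x \<in> feasible G (fst (b i))") auto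
  show sub: "feasible G (fst (b i)) - {x} \<subseteq> actions G"
    using feasible_subset_actions[OF bi] by auto
  show "finite (feasible G (fst (b i)) - {x})"
    using sub finite_actions by (rule finite_subset)
qed

lemma agent_transition_revert:
  assumes "1 \<le> t" "b \<in> joint_actions G" "i \<in> agents G"
  shows "pmf (agent_transition G t a b i) (revert G a b i) = 1 - explor_rate G t"
  using experiment_set[OF assms(2,3)] explor_rate_bounds[OF assms(1)]
  by (simp add: agent_transition_def pmf_bind)

lemma agent_transition_experiment:
  assumes "1 \<le> t" "b \<in> joint_actions G" "i \<in> agents G"
    and x: "x \<in> feasible G (fst (b i))" "x \<noteq> revert G a b i"
  shows "explor_rate G t / card (actions G) \<le> pmf (agent_transition G t a b i) x"
proof -
  let ?F = "feasible G (fst (b i)) - {revert G a b i}"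
  note F = experiment_set[OF assms(2,3), of "revert G a b i"]
  have "pmf (agent_transition G t a b i) x = explor_rate G t / card ?F"
    using F explor_rate_bounds[OF assms(1)] x by (simp add: agent_transition_def pmf_bind)
  moreover have "card ?F \<le> card (actions G)" "0 < card ?F"
    using F by (auto simp: card_gt_0_iff intro: card_mono)
  ultimately show ?thesis
    using explor_rate_bounds[OF assms(1)] by (simp add: frac_le)
qed

lemma agent_transition_not_revert:
  assumes "1 \<le> t" "b \<in> joint_actions G" "i \<in> agents G"
  shows "measure_pmf.prob (agent_transition G t a b i) (- {revert G a b i}) = explor_rate G t"
  using measure_pmf.prob_compl[of "{revert G a b i}" "agent_transition G t a b i"]
    agent_transition_revert[OF assms]
  by (simp add: measure_pmf_single Compl_eq_Diff_UNIV)

lemma set_transition: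
  assumes ab: "a \<in> joint_actions G" "b \<in> joint_actions G"
  shows "set_pmf (transition G t a b) \<subseteq> joint_actions G"
proof -
  have *: "set_pmf (agent_transition G t a b i) \<subseteq> actions G" if i: "i \<in> agents G" for i
  proof -
    have "revert G a b i \<in> actions G"
      using revert_joint_actions[OF ab] i by (auto simp: joint_actions_def)
    then show ?thesis
      using experiment_set[OF ab(2) i, of "revert G a b i"]
      unfolding agent_transition_def set_bind_pmf
      by (intro UN_least) (simp split: if_split)
  qed
  show ?thesis
  proof
    fix y
    assume "y \<in> set_pmf (transition G t a b)"
    then have "\<And>i. i \<in> agents G \<Longrightarrow> y i \<in> set_pmf (agent_transition G t a b i)"
        "\<And>i. i \<notin> agents G \<Longrightarrow> y i = undefined"
      unfolding transition_def set_Pi_pmf[OF finite_agents] PiE_dflt_def by simp_all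
    with * show "y \<in> joint_actions G"
      unfolding joint_actions_def by (intro PiE_I) blast+
  qed
qed

text \<open>The successor without experiments gives the base value. Every other outcome costs at
  most \<open>C\<close>, and together they have probability at most
  \<open>nagents G * explor_rate G t\<close>. One favorable experiment \<open>y0\<close> is credited
  with a gain \<open>d\<close>; the choice \<open>d = 0\<close> means that no outcome is
  credited.\<close>

lemma step_exp_le:
  assumes t: "1 \<le> t" and ab: "a \<in> joint_actions G" "b \<in> joint_actions G" and C: "0 \<le> C"
    and g: "\<And>y. y \<in> joint_actions G \<Longrightarrow> g (b, y) \<le> g (b, revert G a b) + C"
    and y0: "y0 \<in> joint_actions G"
      "d \<noteq> 0 \<Longrightarrow> y0 \<noteq> revert G a b \<and> g (b, y0) \<le> g (b, revert G a b) + C - d"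
  shows "step_exp G t g (a, b)
    \<le> g (b, revert G a b) + C * (nagents G * explor_rate G t) - d * pmf (transition G t a b) y0"
proof -
  let ?X = "{y. \<exists>i\<in>agents G. y i \<noteq> revert G a b i}"
  have X: "y \<in> ?X" if y: "y \<in> joint_actions G" "y \<noteq> revert G a b" for y
  proof -
    obtain i where i: "y i \<noteq> revert G a b i" using y(2) by auto
    then have "i \<in> agents G"
      using joint_actions_arb[OF y(1), of i] joint_actions_arb[OF revert_joint_actions[OF ab], of i]
      by (cases "i \<in> agents G") auto
    with i show ?thesis by auto
  qed
  have "step_exp G t g (a, b) \<le> g (b, revert G a b)
      + C * measure_pmf.prob (transition G t a b) ?X - d * pmf (transition G t a b) y0"
    unfolding step_exp_def prod.case
  proof (rule sum_pmf_bound)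
    show "g (b, y) \<le> g (b, revert G a b) + C * indicator ?X y - d * indicator {y0} y"
      if "y \<in> joint_actions G" for y
      using X[OF that] g[OF that] y0(2) C
      by (cases "d = 0"; cases "y = y0"; cases "y = revert G a b") (auto simp: indicator_def)
  qed (use set_transition[OF ab] C y0 in auto)
  also have "measure_pmf.prob (transition G t a b) ?X \<le> nagents G * explor_rate G t"
    unfolding transition_def
    using prob_Pi_pmf_ne_le[of "agents G" "agent_transition G t a b" "revert G a b"]
      agent_transition_not_revert[OF t ab(2)] by simp
  finally show ?thesis
    using C by (simp add: mult_left_mono)
qed

end

section \<open>Drift of the Lyapunov function\<close>

text \<open>The index \<open>k\<close> serves an induction: a step of the chain without experiments
  turns \<open>k + 1\<close> into \<open>k\<close>, and \<open>k = 0\<close> tests for the diagonal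
  itself.\<close>

definition unsettled :: "coverage_data \<Rightarrow> nat \<Rightarrow> joint_action \<times> joint_action \<Rightarrow> real" where
  "unsettled G k z =
     (if fst ((unperturbed G ^^ k) z) = snd ((unperturbed G ^^ k) z) then 0 else 1)"

text \<open>For small \<open>l\<close> the geometric weights make one step towards \<open>stable_nash G\<close> outweigh any
  retreat, so the function decreases on average away from \<open>stable_nash G\<close>. Composing with
  \<open>limit_state\<close> makes it constant along the dynamics without experiments.\<close>

definition lyapunov :: "coverage_data \<Rightarrow> real \<Rightarrow> joint_action \<times> joint_action \<Rightarrow> real" where
  "lyapunov G l z = (\<Sum>j<stable_dist G (limit_state G z). l ^ j)"

lemma revert_diag [simp]: "revert G s s = s"
  by (simp add: revert_def)

context coverage_game
begin

lemma step_exp_unsettled: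
  assumes "1 \<le> t" "a \<in> joint_actions G" "b \<in> joint_actions G"
  shows "step_exp G t (unsettled G k) (a, b)
    \<le> unsettled G (Suc k) (a, b) + nagents G * explor_rate G t"
proof -
  have "unsettled G k (b, revert G a b) = unsettled G (Suc k) (a, b)"
    by (simp add: unsettled_def funpow_Suc_right unperturbed_def del: funpow.simps)
  then show ?thesis
    using step_exp_le[OF assms, of 1 "unsettled G k" b 0] assms by (simp add: unsettled_def)
qed

text \<open>Agent \<open>i\<close> draws \<open>x\<close> while, independently, no other agent
  experiments.\<close>

lemma transition_deviation:
  assumes t: "1 \<le> t" and s: "s \<in> joint_actions G" and i: "i \<in> agents G"
    and x: "x \<in> feasible G (fst (s i))" "x \<noteq> s i"
  shows "explor_rate G t / card (actions G) * (1 - explor_rate G t) ^ nagents G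
    \<le> pmf (transition G t s s) (s(i := x))"
proof -
  let ?p = "agent_transition G t s s" and ?e = "explor_rate G t"
  note e = explor_rate_bounds[OF t]
  have "pmf (transition G t s s) (s(i := x)) = (\<Prod>j\<in>agents G. pmf (?p j) ((s(i := x)) j))"
    unfolding transition_def using i joint_actions_arb[OF s] by (intro pmf_Pi') auto
  also have "\<dots> = pmf (?p i) x * (\<Prod>j\<in>agents G - {i}. pmf (?p j) (s j))"
    using i by (simp add: prod.remove)
  also have "(\<Prod>j\<in>agents G - {i}. pmf (?p j) (s j)) = (1 - ?e) ^ (nagents G - 1)"
    using i agent_transition_revert[OF t s, of _ s] by simp
  also have "?e / card (actions G) * (1 - ?e) ^ nagents G \<le> pmf (?p i) x * (1 - ?e) ^ (nagents G - 1)"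
    using agent_transition_experiment[OF t s i x(1), of s] x(2) e
    by (intro mult_mono power_decreasing) auto
  finally show ?thesis .
qed

context
  fixes l :: real
  assumes l: "0 < l" "l \<le> 1 / 2"
begin

lemma lyapunov_bounds: "0 \<le> lyapunov G l z" "lyapunov G l z \<le> 2"
  using l geometric_sum_le_add[OF l, of _ 0] by (auto simp: lyapunov_def intro!: sum_nonneg)

text \<open>The distance is positive, so the sum contains its first term
  \<open>l ^ 0 = 1\<close>.\<close>

lemma lyapunov_ge_1:
  assumes "s \<in> joint_actions G" "s \<notin> stable_nash G"
  shows "1 \<le> lyapunov G l (s, s)"
proof -
  obtain s' where "stable_dist G s' < stable_dist G s"
    using stable_dist_step[OF assms] .
  then have "(\<Sum>j\<in>{0}. l ^ j) \<le> lyapunov G l (s, s)"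
    unfolding lyapunov_def limit_state_diag using l by (intro sum_mono2) auto
  then show ?thesis by simp
qed

text \<open>Without experiments the value stays the same by \<open>limit_state_revert\<close>, and
  an experiment changes it by at most 2. This crude first-order bound serves off the
  diagonal.\<close>

lemma step_exp_lyapunov:
  assumes "1 \<le> t" "a \<in> joint_actions G" "b \<in> joint_actions G"
  shows "step_exp G t (lyapunov G l) (a, b)
    \<le> lyapunov G l (a, b) + 2 * (nagents G * explor_rate G t)"
proof -
  have "lyapunov G l (b, revert G a b) = lyapunov G l (a, b)"
    using assms by (simp add: lyapunov_def limit_state_revert)
  moreover have "lyapunov G l z \<le> lyapunov G l z' + 2" for z z'
    using lyapunov_bounds[of z] lyapunov_bounds[of z'] by simp
  ultimately show ?thesis
    using step_exp_le[OF assms, of 2 "lyapunov G l" b 0] assms by simp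
qed

text \<open>After a single experiment the limit state is still stable, since
  \<open>stable_nash G\<close> is closed under better replies. Only outcomes with two experimenters
  count, and their probability is of second order.\<close>

lemma step_exp_lyapunov_stable:
  assumes t: "1 \<le> t" and s: "s \<in> stable_nash G"
  shows "step_exp G t (lyapunov G l) (s, s) \<le> 2 * ((nagents G)\<^sup>2 * (explor_rate G t)\<^sup>2)"
proof -
  have sA: "s \<in> joint_actions G"
    using s by (simp add: stable_nash_def)
  let ?X = "{y. \<exists>i\<in>agents G. \<exists>j\<in>agents G. i \<noteq> j \<and> y i \<noteq> s i \<and> y j \<noteq> s j}"
  \<comment> \<open>Restricted to the support, because there the action of a single deviator is
    known to be feasible.\<close>
  have h: "lyapunov G l (s, y) \<le> 0 + 2 * indicator ?X y - 0 * indicator {s} y"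
    if y: "y \<in> set_pmf (transition G t s s)" for y
  proof -
    consider "y \<in> ?X" | "y = s" | "y \<notin> ?X" "y \<noteq> s" by blast
    then show ?thesis
    proof cases
      case 1
      then have "indicator ?X y = (1 :: real)" by (rule indicator_simps)
      then show ?thesis using lyapunov_bounds[of "(s, y)"] by simp
    next
      case 2
      then show ?thesis using stable_dist_eq_0[OF s] by (simp add: lyapunov_def)
    next
      case False: 3
      have yA: "y \<in> joint_actions G" using y set_transition[OF sA sA] by blast
      obtain i where i: "y i \<noteq> s i" using False(2) by (meson ext)
      then have iA: "i \<in> agents G"
        using joint_actions_arb[OF yA, of i] joint_actions_arb[OF sA, of i]
        by (cases "i \<in> agents G") auto
      have y_eq: "y = s(i := y i)"
      proof
        fix j
        show "y j = (s(i := y i)) j"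
          using False i iA joint_actions_arb[OF yA, of j] joint_actions_arb[OF sA, of j]
          by (cases "j \<in> agents G") auto
      qed
      have "y i \<in> set_pmf (agent_transition G t s s i)"
        using y iA unfolding transition_def set_Pi_pmf[OF finite_agents] PiE_dflt_def by simp
      then have "y i \<in> feasible G (fst (s i))"
        using i experiment_set[OF sA iA, of "s i"] by (auto simp: agent_transition_def split: if_splits)
      then have "utility G i s \<le> utility G i y \<Longrightarrow> (s, y) \<in> better_reply G"
        using sA iA y_eq unfolding better_reply_def by (subst (asm) y_eq) blast
      moreover have "limit_state G (s, y) = (if utility G i s \<le> utility G i y then y else s)"
        using limit_state_deviation[of s i "y i"] sA yA unfolding y_eq[symmetric] .
      ultimately have "limit_state G (s, y) \<in> stable_nash G"
        using s stable_nash_closed by auto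
      then show ?thesis
        using stable_dist_eq_0 by (simp add: lyapunov_def)
    qed
  qed
  let ?p = "transition G t s s"
  have "step_exp G t (lyapunov G l) (s, s)
      = (\<Sum>y\<in>joint_actions G \<inter> set_pmf ?p. pmf ?p y * lyapunov G l (s, y))"
    unfolding step_exp_def prod.case
    by (intro sum.mono_neutral_right) (auto simp: set_pmf_iff)
  also have "\<dots> \<le> (\<Sum>y\<in>joint_actions G \<inter> set_pmf ?p. pmf ?p y * (2 * indicator ?X y))"
    using h by (intro sum_mono mult_left_mono) auto
  also have "\<dots> \<le> (\<Sum>y\<in>joint_actions G. pmf ?p y * (2 * indicator ?X y))"
    by (intro sum_mono2) auto
  also have "\<dots> \<le> 0 + 2 * measure_pmf.prob ?p ?X - 0 * pmf ?p s"
    using set_transition[OF sA sA] sA by (intro sum_pmf_bound) auto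
  also have "measure_pmf.prob ?p ?X \<le> (nagents G)\<^sup>2 * (explor_rate G t)\<^sup>2"
    unfolding transition_def
    using prob_Pi_pmf_ne2_le[of "agents G" "agent_transition G t s s" s]
      agent_transition_not_revert[OF t sA, of _ s] by simp
  finally show ?thesis by simp
qed

text \<open>The first step of a shortest path to \<open>stable_nash G\<close> is a single experiment
  that lowers the value by at least \<open>l ^ n\<close>, where \<open>n + 1\<close> is the
  distance. Other outcomes raise it by at most \<open>2 * l ^ (n + 1)\<close>, and \<open>l\<close>
  is chosen so small that the gain prevails on average.\<close>

lemma step_exp_lyapunov_unstable:
  assumes t: "1 \<le> t" and s: "s \<in> joint_actions G" "s \<notin> stable_nash G"
    and l_def: "l = 1 / (8 * nagents G * card (actions G))"
    and e: "1 / 2 \<le> (1 - explor_rate G t) ^ nagents G"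
  shows "step_exp G t (lyapunov G l) (s, s) \<le> lyapunov G l (s, s)
    - l ^ stable_dist G s * explor_rate G t / (4 * card (actions G))"
proof -
  let ?d = "stable_dist G s" and ?e = "explor_rate G t" and ?w = "1 / real (card (actions G))"
  obtain s' where s': "(s, s') \<in> better_reply G" "stable_dist G s' < ?d"
    using stable_dist_step[OF s] .
  then obtain i x where ix: "s' = s(i := x)" "i \<in> agents G" "x \<in> feasible G (fst (s i))"
      "utility G i s \<le> utility G i s'"
    by (auto simp: better_reply_def)
  have s'A: "s' \<in> joint_actions G"
    using s'(1) by (rule better_reply_joint_actions)
  have "s' \<noteq> s" using s'(2) by auto
  then have x: "x \<noteq> s i" using ix(1) by auto
  obtain n where n: "?d = Suc n" using s'(2) by (cases ?d) auto
  have lim: "limit_state G (s, s') = s'"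
    using limit_state_deviation[of s i x] s(1) s'A ix by simp
  have sum: "(\<Sum>j<m. l ^ j) \<le> (\<Sum>j<?d. l ^ j) + 2 * l ^ ?d" for m
    by (rule geometric_sum_le_add[OF l])
  have "(\<Sum>j<stable_dist G s'. l ^ j) \<le> (\<Sum>j<n. l ^ j)"
    using s'(2) n l by (intro sum_mono2) auto
  then have "lyapunov G l (s, s') \<le> lyapunov G l (s, s) - l ^ n"
    by (simp add: lyapunov_def lim n)
  moreover have "0 \<le> 2 * l ^ ?d" using l by simp
  ultimately have "step_exp G t (lyapunov G l) (s, s) \<le> lyapunov G l (s, s)
      + 2 * l ^ ?d * (nagents G * ?e) - l ^ n * pmf (transition G t s s) s'"
    using step_exp_le[OF t s(1) s(1), of "2 * l ^ ?d" "lyapunov G l" s' "l ^ n"] s'A \<open>s' \<noteq> s\<close> sum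
    by (simp add: lyapunov_def)
  \<comment> \<open>The scale of the gain: the expected gain is at least \<open>P / 2\<close> and
    the expected loss at most \<open>P / 4\<close>, which leaves a decrease of
    \<open>P / 4\<close>.\<close>
  moreover define P where "P = l ^ n * (?e * ?w)"
  moreover have "P / 2 \<le> l ^ n * pmf (transition G t s s) s'"
  proof -
    have "?e * ?w * (1 / 2) \<le> ?e * ?w * (1 - ?e) ^ nagents G"
      using e explor_rate_bounds[OF t] by (intro mult_left_mono) auto
    also have "\<dots> \<le> pmf (transition G t s s) s'"
      using transition_deviation[OF t s(1) ix(2,3) x] ix(1) by simp
    finally have "l ^ n * (?e * ?w * (1 / 2)) \<le> l ^ n * pmf (transition G t s s) s'"
      using l by (intro mult_left_mono) auto
    then show ?thesis by (simp add: P_def)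
  qed
  moreover have "2 * l ^ ?d * (nagents G * ?e) = P / 4"
  proof -
    have "2 * l * nagents G = ?w * (1 / 4)"
      using nagents_pos by (simp add: l_def)
    moreover have "2 * l ^ ?d * (nagents G * ?e) = l ^ n * (?e * (2 * l * nagents G))"
      by (simp add: n)
    ultimately show ?thesis by (simp add: P_def)
  qed
  moreover have "l ^ ?d * ?e / (4 * card (actions G)) \<le> P / 4"
  proof -
    have "l ^ ?d \<le> l ^ n" using l n by (intro power_decreasing) auto
    then have "l ^ ?d * (?e * ?w * (1 / 4)) \<le> l ^ n * (?e * ?w * (1 / 4))"
      using explor_rate_bounds[OF t] by (intro mult_right_mono) auto
    then show ?thesis by (simp add: P_def mult.commute)
  qed
  ultimately show ?thesis by linarith
qed

end

text \<open>Off the diagonal the crude bound is paid for by the term with \<open>unsettled\<close>.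
  At stable states the function is 0 and its mean grows at second order only. At other diagonal
  states the strict decrease yields the contraction.\<close>

lemma lyapunov_drift:
  obtains l c C :: real where "0 < l" "l \<le> 1 / 2" "0 < c" "c \<le> 1" "0 \<le> C"
    "\<forall>\<^sub>F t in sequentially. \<forall>a\<in>joint_actions G. \<forall>b\<in>joint_actions G.
       step_exp G t (lyapunov G l) (a, b) \<le> (1 - c * explor_rate G t) * lyapunov G l (a, b)
         + C * (explor_rate G t)\<^sup>2 + C * explor_rate G t * unsettled G 0 (a, b)"
proof -
  let ?N = "real (nagents G)" and ?K = "real (card (actions G))" and ?e = "explor_rate G"
  define l where "l = 1 / (8 * ?N * ?K)"
  have N: "1 \<le> ?N" using nagents_pos by simp
  have K: "1 \<le> ?K"
    using actions_nonempty by (simp add: Suc_le_eq card_gt_0_iff)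
  have NK: "1 \<le> ?N * ?K" using N K mult_mono[of 1 ?N 1 ?K] by simp
  have l: "0 < l" "l \<le> 1 / 2"
    using NK by (auto simp: l_def field_simps)
  define D where "D = Max (stable_dist G ` joint_actions G)"
  have D: "stable_dist G s \<le> D" if "s \<in> joint_actions G" for s
    using that by (auto simp: D_def)
  \<comment> \<open>The decrease at unstable states is at least
    \<open>2 * c * explor_rate G t\<close>, which dominates \<open>c * explor_rate G t\<close> times
    the function, as the latter is at most 2.\<close>
  define c where "c = l ^ D / (8 * ?K)"
  have lD: "0 < l ^ D" "l ^ D \<le> 1" using l by (auto intro: power_le_one)
  have c: "0 < c" "c \<le> 1" using lD K by (auto simp: c_def field_simps)
  \<comment> \<open>The first summand serves the stable case, the other two the case off the
    diagonal, where \<open>2 * c \<le> 2\<close>.\<close>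
  define C where "C = 2 * ?N\<^sup>2 + 2 * ?N + 2"
  have C: "0 \<le> C" by (simp add: C_def)
  have "(\<lambda>t. (1 - ?e t) ^ nagents G) \<longlonglongrightarrow> (1 - 0) ^ nagents G"
    by (intro tendsto_intros explor_rate_tendsto)
  then have "\<forall>\<^sub>F t in sequentially. 1 / 2 < (1 - ?e t) ^ nagents G"
    by (rule order_tendstoD) simp
  then have "\<forall>\<^sub>F t in sequentially. \<forall>a\<in>joint_actions G. \<forall>b\<in>joint_actions G.
       step_exp G t (lyapunov G l) (a, b) \<le> (1 - c * ?e t) * lyapunov G l (a, b)
         + C * (?e t)\<^sup>2 + C * ?e t * unsettled G 0 (a, b)"
    using eventually_ge_at_top[of 1]
  proof eventually_elim
    case (elim t)
    note e = explor_rate_bounds[OF elim(2)]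
    show ?case
    proof (intro ballI)
      fix a b
      assume ab: "a \<in> joint_actions G" "b \<in> joint_actions G"
      let ?V = "lyapunov G l (a, b)"
      have V: "0 \<le> ?V" "?V \<le> 2" using lyapunov_bounds[OF l] by auto
      have cV: "c * ?e t * ?V \<le> c * ?e t * 2"
        using V c e by (intro mult_left_mono) auto
      have e2: "0 \<le> C * (?e t)\<^sup>2" using C by simp
      consider "a \<noteq> b" | "a = b" "a \<in> stable_nash G" | "a = b" "a \<notin> stable_nash G" by blast
      then show "step_exp G t (lyapunov G l) (a, b) \<le> (1 - c * ?e t) * ?V
         + C * (?e t)\<^sup>2 + C * ?e t * unsettled G 0 (a, b)"
      proof cases
        case 1
        have "2 * ?N + 2 * c \<le> C"
          using c zero_le_power2[of ?N] unfolding C_def by linarith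
        then have "(2 * ?N + 2 * c) * ?e t \<le> C * ?e t"
          using e by (intro mult_right_mono)
        then show ?thesis
          using step_exp_lyapunov[OF l elim(2) ab] cV e2 1
          by (simp add: unsettled_def algebra_simps)
      next
        case 2
        have "2 * (?N\<^sup>2 * (?e t)\<^sup>2) \<le> C * (?e t)\<^sup>2"
          by (simp add: C_def algebra_simps)
        moreover have "?V = 0"
          using 2 by (simp add: lyapunov_def stable_dist_eq_0)
        ultimately show ?thesis
          using step_exp_lyapunov_stable[OF l elim(2) 2(2)] 2 by (simp add: unsettled_def)
      next
        case 3
        have "l ^ D \<le> l ^ stable_dist G a"
          using l D[OF ab(1)] by (intro power_decreasing) auto
        then have "l ^ D * (?e t / (4 * ?K)) \<le> l ^ stable_dist G a * (?e t / (4 * ?K))"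
          using e K by (intro mult_right_mono) auto
        moreover have "c * ?e t * 2 = l ^ D * (?e t / (4 * ?K))"
          by (simp add: c_def)
        moreover have "step_exp G t (lyapunov G l) (a, b)
            \<le> ?V - l ^ stable_dist G a * ?e t / (4 * ?K)"
          using step_exp_lyapunov_unstable[OF l elim(2) ab(1) 3(2)] elim(1) 3(1)
          by (simp add: l_def)
        ultimately show ?thesis
          using cV e2 3 by (simp add: unsettled_def algebra_simps)
      qed
    qed
  qed
  with that l c C show thesis by blast
qed

end

section \<open>The process\<close>

context discl_process
begin

lemma S_measurable [measurable]: "S t \<in> M \<rightarrow>\<^sub>M count_space UNIV"
proof -
  have "id \<in> count_space (joint_actions G) \<rightarrow>\<^sub>M count_space UNIV" by simp
  from measurable_comp[OF rv[of t] this] show ?thesis by simp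
qed

lemma S_joint_actions: "\<omega> \<in> space M \<Longrightarrow> S t \<omega> \<in> joint_actions G"
  using rv[of t] by (auto dest: measurable_space)

text \<open>Sum \<open>update\<close> over all histories that end in \<open>a\<close> and
  \<open>b\<close>. They share the same conditional law of the next joint action, which therefore
  factors out.\<close>

lemma S_update:
  assumes t: "2 \<le> t"
  shows "prob {\<omega> \<in> space M. S (t - 1) \<omega> = a \<and> S t \<omega> = b \<and> S (Suc t) \<omega> = y}
    = prob {\<omega> \<in> space M. S (t - 1) \<omega> = a \<and> S t \<omega> = b} * pmf (transition G t a b) y"
proof -
  \<comment> \<open>Histories are extensional functions on \<open>{..t}\<close>: there are finitely
    many, and distinct ones define disjoint events.\<close>
  define H where "H = {x \<in> {..t} \<rightarrow>\<^sub>E joint_actions G. x (t - 1) = a \<and> x t = b}"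
  have H: "finite H" by (simp add: H_def finite_PiE)
  define E where "E x = {\<omega> \<in> space M. \<forall>k\<le>t. S k \<omega> = x k}" for x
  define E' where "E' x = {\<omega> \<in> space M. (\<forall>k\<le>t. S k \<omega> = x k) \<and> S (Suc t) \<omega> = y}" for x
  have meas: "E ` H \<subseteq> events" "E' ` H \<subseteq> events"
    by (auto simp: E_def E'_def)
  have E_eq: "x = restrict (\<lambda>k. S k \<omega>) {..t}" if "x \<in> H" "\<omega> \<in> E x" for x \<omega>
    using that by (intro PiE_ext[of x "{..t}"]) (auto simp: H_def E_def)
  have sub: "E' x \<subseteq> E x" for x by (auto simp: E_def E'_def)
  have E_inj: "x = x'" if "x \<in> H" "x' \<in> H" "\<omega> \<in> E x" "\<omega> \<in> E x'" for x x' \<omega>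
    using E_eq[OF that(1,3)] E_eq[OF that(2,4)] by (rule trans[OF _ sym])
  then have disj: "disjoint_family_on E H"
    unfolding disjoint_family_on_def by blast
  with sub have disj': "disjoint_family_on E' H"
    unfolding disjoint_family_on_def by blast
  have in_H: "restrict (\<lambda>k. S k \<omega>) {..t} \<in> H"
    if "\<omega> \<in> space M" "S (t - 1) \<omega> = a" "S t \<omega> = b" for \<omega>
    using that S_joint_actions by (auto simp: H_def)
  have "{\<omega> \<in> space M. S (t - 1) \<omega> = a \<and> S t \<omega> = b \<and> S (Suc t) \<omega> = y} = (\<Union>x\<in>H. E' x)"
  proof (intro equalityI subsetI)
    fix \<omega>
    assume \<omega>: "\<omega> \<in> {\<omega> \<in> space M. S (t - 1) \<omega> = a \<and> S t \<omega> = b \<and> S (Suc t) \<omega> = y}"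
    then have "\<omega> \<in> E' (restrict (\<lambda>k. S k \<omega>) {..t})" by (simp add: E'_def)
    with \<omega> in_H[of \<omega>] show "\<omega> \<in> (\<Union>x\<in>H. E' x)" by blast
  qed (auto simp: H_def E'_def)
  then have "prob {\<omega> \<in> space M. S (t - 1) \<omega> = a \<and> S t \<omega> = b \<and> S (Suc t) \<omega> = y}
      = (\<Sum>x\<in>H. prob (E' x))"
    using finite_measure_finite_Union[OF H meas(2) disj'] by simp
  also have "\<dots> = (\<Sum>x\<in>H. prob (E x) * pmf (transition G t a b) y)"
    using t by (intro sum.cong) (auto simp: E_def E'_def update joint_update_eq H_def)
  also have "\<dots> = (\<Sum>x\<in>H. prob (E x)) * pmf (transition G t a b) y"
    by (simp add: sum_distrib_right)
  also have "(\<Sum>x\<in>H. prob (E x)) = prob (\<Union>x\<in>H. E x)"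
    using finite_measure_finite_Union[OF H meas(1) disj] by simp
  also have "(\<Union>x\<in>H. E x) = {\<omega> \<in> space M. S (t - 1) \<omega> = a \<and> S t \<omega> = b}"
  proof (intro equalityI subsetI)
    fix \<omega>
    assume \<omega>: "\<omega> \<in> {\<omega> \<in> space M. S (t - 1) \<omega> = a \<and> S t \<omega> = b}"
    then have "\<omega> \<in> E (restrict (\<lambda>k. S k \<omega>) {..t})" by (simp add: E_def)
    with \<omega> in_H[of \<omega>] show "\<omega> \<in> (\<Union>x\<in>H. E x)" by blast
  qed (auto simp: H_def E_def)
  finally show ?thesis .
qed

section \<open>Expectations of functions of the chain\<close>

definition law :: "nat \<Rightarrow> joint_action \<times> joint_action \<Rightarrow> real" where
  "law t z = prob {\<omega> \<in> space M. chain S t \<omega> = z}"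

definition chain_exp :: "nat \<Rightarrow> (joint_action \<times> joint_action \<Rightarrow> real) \<Rightarrow> real" where
  "chain_exp t g = (\<Sum>z\<in>joint_actions G \<times> joint_actions G. law t z * g z)"

lemma chain_event: "{\<omega> \<in> space M. chain S t \<omega> = z} \<in> events"
proof -
  have "{\<omega> \<in> space M. chain S t \<omega> = z} = {\<omega> \<in> space M. S (t - 1) \<omega> = fst z \<and> S t \<omega> = snd z}"
    by (auto simp: chain_def)
  then show ?thesis by simp
qed

lemma law_nonneg: "0 \<le> law t z"
  by (simp add: law_def)

lemma prob_chain:
  "prob {\<omega> \<in> space M. chain S t \<omega> \<in> B} = chain_exp t (indicator B)"
proof -
  let ?J = "(joint_actions G \<times> joint_actions G) \<inter> B"
  have fin: "finite ?J" by simp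
  have "{\<omega> \<in> space M. chain S t \<omega> \<in> B} = (\<Union>z\<in>?J. {\<omega> \<in> space M. chain S t \<omega> = z})"
    using S_joint_actions by (auto simp: chain_def)
  also have "prob \<dots> = (\<Sum>z\<in>?J. law t z)"
    unfolding law_def using chain_event fin
    by (intro finite_measure_finite_Union) (auto simp: disjoint_family_on_def)
  also have "\<dots> = chain_exp t (indicator B)"
    by (simp add: chain_exp_def indicator_def if_distrib sum.inter_restrict)
  finally show ?thesis .
qed

lemma chain_exp_const: "chain_exp t (\<lambda>z. k) = k"
proof -
  have "chain_exp t (indicator UNIV) = 1"
    using prob_chain[of t UNIV] by (simp add: prob_space)
  then have "(\<Sum>z\<in>joint_actions G \<times> joint_actions G. law t z) = 1"
    by (simp add: chain_exp_def)
  then show ?thesis by (simp add: chain_exp_def sum_distrib_right[symmetric])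
qed

lemma chain_exp_mono:
  assumes "\<And>a b. a \<in> joint_actions G \<Longrightarrow> b \<in> joint_actions G \<Longrightarrow> g (a, b) \<le> h (a, b)"
  shows "chain_exp t g \<le> chain_exp t h"
  unfolding chain_exp_def using assms law_nonneg by (intro sum_mono mult_left_mono) auto

lemma chain_exp_add: "chain_exp t (\<lambda>z. g z + h z) = chain_exp t g + chain_exp t h"
  by (simp add: chain_exp_def distrib_left sum.distrib)

lemma chain_exp_scale: "chain_exp t (\<lambda>z. k * g z) = k * chain_exp t g"
  by (simp add: chain_exp_def sum_distrib_left mult.left_commute)

text \<open>The tower property, obtained from \<open>S_update\<close> by summing over the joint
  action at time \<open>t - 1\<close>, which the next state no longer contains.\<close>

lemma chain_exp_Suc:
  assumes t: "2 \<le> t"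
  shows "chain_exp (Suc t) g = chain_exp t (step_exp G t g)"
proof -
  let ?A = "joint_actions G"
  have law_Suc: "law (Suc t) (b, y) = (\<Sum>a\<in>?A. law t (a, b) * pmf (transition G t a b) y)" for b y
  proof -
    let ?E = "\<lambda>a. {\<omega> \<in> space M. S (t - 1) \<omega> = a \<and> S t \<omega> = b \<and> S (Suc t) \<omega> = y}"
    have "{\<omega> \<in> space M. chain S (Suc t) \<omega> = (b, y)} = (\<Union>a\<in>?A. ?E a)"
      using S_joint_actions by (auto simp: chain_def)
    also have "prob \<dots> = (\<Sum>a\<in>?A. prob (?E a))"
      by (intro finite_measure_finite_Union) (auto simp: disjoint_family_on_def)
    also have "\<dots> = (\<Sum>a\<in>?A. law t (a, b) * pmf (transition G t a b) y)"
    proof (intro sum.cong refl)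
      fix a
      show "prob (?E a) = law t (a, b) * pmf (transition G t a b) y"
        using S_update[OF t, of a b y] by (simp add: law_def chain_def)
    qed
    finally show ?thesis
      unfolding law_def .
  qed
  have "chain_exp (Suc t) g = (\<Sum>b\<in>?A. \<Sum>y\<in>?A. law (Suc t) (b, y) * g (b, y))"
    by (simp add: chain_exp_def sum.cartesian_product)
  also have "\<dots> = (\<Sum>b\<in>?A. \<Sum>y\<in>?A. \<Sum>a\<in>?A. law t (a, b) * pmf (transition G t a b) y * g (b, y))"
    by (simp add: law_Suc sum_distrib_right)
  also have "\<dots> = (\<Sum>b\<in>?A. \<Sum>a\<in>?A. \<Sum>y\<in>?A. law t (a, b) * pmf (transition G t a b) y * g (b, y))"
    by (intro sum.cong refl sum.swap)
  also have "\<dots> = (\<Sum>a\<in>?A. \<Sum>b\<in>?A. \<Sum>y\<in>?A. law t (a, b) * pmf (transition G t a b) y * g (b, y))"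
    by (rule sum.swap)
  also have "\<dots> = (\<Sum>a\<in>?A. \<Sum>b\<in>?A. law t (a, b) * step_exp G t g (a, b))"
    by (simp add: step_exp_def sum_distrib_left mult.assoc)
  also have "\<dots> = chain_exp t (step_exp G t g)"
    by (simp add: chain_exp_def sum.cartesian_product)
  finally show ?thesis .
qed

text \<open>Downward induction from \<open>k = 2 * nagents G\<close>, where the expectation vanishes
  identically. Each step advances time by one and adds an error that tends to 0 with the exploration
  rate. For \<open>k = 0\<close> this is the probability of being off the diagonal.\<close>

lemma unsettled_tendsto:
  assumes "k \<le> 2 * nagents G"
  shows "(\<lambda>t. chain_exp t (unsettled G k)) \<longlonglongrightarrow> 0"
  using assms
proof (induction k rule: inc_induct)
  case base
  have "chain_exp t (unsettled G (2 * nagents G)) = 0" for t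
    unfolding chain_exp_def
  proof (intro sum.neutral ballI)
    fix z
    assume "z \<in> joint_actions G \<times> joint_actions G"
    then obtain s where "(unperturbed G ^^ (2 * nagents G)) z = (s, s)"
      using unperturbed_settles[of "fst z" "snd z"] by auto
    then show "law t z * unsettled G (2 * nagents G) z = 0"
      by (simp add: unsettled_def)
  qed
  then show ?case by simp
next
  case (step k)
  have nonneg: "0 \<le> chain_exp t (unsettled G k)" for t
    unfolding chain_exp_def using law_nonneg by (intro sum_nonneg mult_nonneg_nonneg) (auto simp: unsettled_def)
  have le: "chain_exp (Suc t) (unsettled G k)
      \<le> chain_exp t (unsettled G (Suc k)) + nagents G * explor_rate G t" if t: "2 \<le> t" for t
  proof -
    have "chain_exp t (step_exp G t (unsettled G k))
        \<le> chain_exp t (\<lambda>z. unsettled G (Suc k) z + nagents G * explor_rate G t)"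
      using t by (intro chain_exp_mono step_exp_unsettled) auto
    then show ?thesis
      by (simp add: chain_exp_Suc[OF t] chain_exp_add chain_exp_const)
  qed
  have "(\<lambda>t. chain_exp t (unsettled G (Suc k)) + nagents G * explor_rate G t)
      \<longlonglongrightarrow> 0 + real (nagents G) * 0"
    by (intro tendsto_intros step.IH explor_rate_tendsto)
  then have lim: "(\<lambda>t. chain_exp t (unsettled G (Suc k)) + nagents G * explor_rate G t) \<longlonglongrightarrow> 0"
    by simp
  have ev: "\<forall>\<^sub>F t in sequentially. chain_exp (Suc t) (unsettled G k)
      \<le> chain_exp t (unsettled G (Suc k)) + nagents G * explor_rate G t"
    using eventually_ge_at_top[of 2] by eventually_elim (rule le)
  have "(\<lambda>t. chain_exp (Suc t) (unsettled G k)) \<longlonglongrightarrow> 0"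
    by (rule tendsto_sandwich[OF _ ev tendsto_const lim]) (simp add: nonneg)
  then show ?case by (rule LIMSEQ_imp_Suc)
qed

text \<open>A state outside \<open>Id_on (constrained_nash G)\<close> is off the diagonal or
  unstable, so \<open>unsettled G 0\<close> or \<open>lyapunov G l\<close> is at least 1 there, and
  both have expectations tending to 0.\<close>

lemma chain_tendsto_nash:
  "(\<lambda>t. prob {\<omega> \<in> space M. chain S t \<omega> \<in> Id_on (constrained_nash G)}) \<longlonglongrightarrow> 1"
proof -
  obtain l c C :: real where l: "0 < l" "l \<le> 1 / 2" and c: "0 < c" "c \<le> 1" and C: "0 \<le> C"
    and drift: "\<forall>\<^sub>F t in sequentially. \<forall>a\<in>joint_actions G. \<forall>b\<in>joint_actions G.
       step_exp G t (lyapunov G l) (a, b) \<le> (1 - c * explor_rate G t) * lyapunov G l (a, b)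
         + C * (explor_rate G t)\<^sup>2 + C * explor_rate G t * unsettled G 0 (a, b)"
    by (rule lyapunov_drift)
  define v where "v t = chain_exp t (lyapunov G l)" for t
  define off where "off t = chain_exp t (unsettled G 0)" for t
  have off: "off \<longlonglongrightarrow> 0"
    using unsettled_tendsto[of 0] by (simp add: off_def[abs_def])
  have v: "v \<longlonglongrightarrow> 0"
  \<comment> \<open>The contraction rate is \<open>c * explor_rate G t\<close>. Each error term
    contains the factor \<open>explor_rate G t\<close>, so dividing by the rate leaves
    \<open>C / c * (explor_rate G t + off t)\<close>, which still tends to 0.\<close>
  proof (rule contraction_tendsto_zero)
    show "\<forall>\<^sub>F t in sequentially. v (Suc t) \<le> (1 - c * explor_rate G t) * v t
        + c * explor_rate G t * (C / c * (explor_rate G t + off t))"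
      using drift eventually_ge_at_top[of 2]
    proof eventually_elim
      case (elim t)
      have "v (Suc t) \<le> chain_exp t (\<lambda>z. (1 - c * explor_rate G t) * lyapunov G l z
          + C * (explor_rate G t)\<^sup>2 + C * explor_rate G t * unsettled G 0 z)"
        unfolding v_def chain_exp_Suc[OF elim(2)] using elim(1) by (intro chain_exp_mono) auto
      also have "\<dots> = (1 - c * explor_rate G t) * v t + C * (explor_rate G t)\<^sup>2
          + C * explor_rate G t * off t"
        by (simp only: chain_exp_add chain_exp_scale chain_exp_const v_def off_def)
      also have "C * (explor_rate G t)\<^sup>2 = c * explor_rate G t * (C / c * explor_rate G t)"
        using c by (simp add: power2_eq_square)
      also have "C * explor_rate G t * off t = c * explor_rate G t * (C / c * off t)"
        using c by simp
      finally show ?case by (simp add: distrib_left add.assoc)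
    qed
    show "0 \<le> v t" for t
      unfolding v_def chain_exp_def using law_nonneg lyapunov_bounds[OF l]
      by (intro sum_nonneg mult_nonneg_nonneg) auto
    show "\<forall>\<^sub>F t in sequentially. 0 \<le> c * explor_rate G t \<and> c * explor_rate G t \<le> 1"
      using eventually_ge_at_top[of 1]
      by eventually_elim (use c explor_rate_bounds in \<open>auto intro: mult_le_one\<close>)
    show "\<not> summable (\<lambda>t. c * explor_rate G t)"
      using c explor_rate_not_summable by (simp add: summable_cmult_iff)
    have "(\<lambda>t. C / c * (explor_rate G t + off t)) \<longlonglongrightarrow> C / c * (0 + 0)"
      by (intro tendsto_intros explor_rate_tendsto off)
    then show "(\<lambda>t. C / c * (explor_rate G t + off t)) \<longlonglongrightarrow> 0" by simp
  qed
  let ?p = "\<lambda>t. prob {\<omega> \<in> space M. chain S t \<omega> \<in> Id_on (constrained_nash G)}"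
  have "1 - (off t + v t) \<le> ?p t" for t
  proof -
    have "1 = chain_exp t (\<lambda>z. 1)"
      by (simp add: chain_exp_const)
    also have "\<dots> \<le> chain_exp t (\<lambda>z. indicator (Id_on (constrained_nash G)) z
        + (unsettled G 0 z + lyapunov G l z))"
    proof (rule chain_exp_mono)
      fix a b
      assume ab: "a \<in> joint_actions G" "b \<in> joint_actions G"
      consider "a \<noteq> b" | "a = b" "a \<in> constrained_nash G" | "a = b" "a \<notin> stable_nash G"
        using stable_nash_subset by blast
      then show "1 \<le> indicator (Id_on (constrained_nash G)) (a, b)
          + (unsettled G 0 (a, b) + lyapunov G l (a, b))"
        using lyapunov_bounds(1)[OF l, of "(a, b)"] lyapunov_ge_1[OF l ab(1)]
        by cases (auto simp: unsettled_def indicator_def)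
    qed
    also have "\<dots> = ?p t + (off t + v t)"
      by (simp only: chain_exp_add prob_chain off_def v_def)
    finally show ?thesis by simp
  qed
  then have lower: "\<forall>\<^sub>F t in sequentially. 1 - (off t + v t) \<le> ?p t"
    by simp
  have "(\<lambda>t. 1 - (off t + v t)) \<longlonglongrightarrow> 1 - (0 + 0)"
    by (intro tendsto_intros off v)
  then have lim: "(\<lambda>t. 1 - (off t + v t)) \<longlonglongrightarrow> 1" by simp
  show ?thesis
    by (rule tendsto_sandwich[OF lower _ lim tendsto_const]) simp
qed

end

theorem theorem3p1:
  fixes G :: coverage_data and M :: "'w measure" and S :: "nat \<Rightarrow> 'w \<Rightarrow> joint_action"
  assumes "discl_process G M S"
  shows "(\<lambda>t. measure M {\<omega> \<in> space M. chain S t \<omega> \<in> Id_on (constrained_nash G)})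
           \<longlonglongrightarrow> 1"
  using assms by (rule discl_process.chain_tendsto_nash)

end
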